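(* Let $n\ge 1$ and let $Q_n(x)$ be the associated polynomial of the Dynkin diagram of type $A_n$. Then $$Q_n(x)=\prod_{\substack{j\mid 2n+2\\ j\neq 1,2}}\Phi_j(x),$$ where $j$ runs over the positive divisors of $2n+2$ other than $1$ and $2$, and $\Phi_j$ denotes the $j$-th cyclotomic polynomial.
   Context: Let $C$ be the $n\times n$ Cartan matrix of type $A_n$, i.e. the tridiagonal matrix with all diagonal entries $2$ and all entries on the sub- and superdiagonals $-1$. The Coxeter adjacency matrix is $A=2I_n-C$, and $a_n(x)=\det(xI_n-A)$ is its characteristic polynomial. The associated polynomial is $Q_n(x)=x^n a_n\left(x+\frac1x\right)$, a polynomial of degree $2n$. *)

theory Defs
  imports Complex_Main "Jordan_Normal_Form.Char_Poly"
begin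

text \<open>Matrix indices start at 0.\<close>

definition cartan_matrix_A :: "nat \<Rightarrow> int mat" where
  "cartan_matrix_A n = mat n n (\<lambda>(i, j).
     if i = j then 2 else if i = j + 1 \<or> j = i + 1 then -1 else 0)"

lemma cartan_matrix_A_carrier: "cartan_matrix_A n \<in> carrier_mat n n"
  by (simp add: cartan_matrix_A_def)

definition coxeter_adjacency :: "int mat \<Rightarrow> int mat" where
  "coxeter_adjacency C = 2 \<cdot>\<^sub>m 1\<^sub>m (dim_row C) - C"

text \<open>
  The polynomial \<open>Q\<close> with \<open>Q(x) = x\<^sup>n a(x + 1/x)\<close>, where \<open>a\<close> is the
  characteristic polynomial of the Coxeter adjacency matrix of an \<open>n\<close> by \<open>n\<close> matrix.
  As \<open>x + 1/x\<close> is not a polynomial, the identity is required at all nonzero complex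
  numbers. The lemmas below show that this determines a unique polynomial when the matrix
  is square.
\<close>

definition associated_poly :: "int mat \<Rightarrow> int poly" where
  "associated_poly C = (THE Q. \<forall>x::complex. x \<noteq> 0 \<longrightarrow>
     poly (map_poly of_int Q) x =
       x ^ dim_row C * poly (map_poly of_int (char_poly (coxeter_adjacency C))) (x + 1 / x))"

definition primitive_root_of_unity :: "nat \<Rightarrow> complex \<Rightarrow> bool" where
  "primitive_root_of_unity j z \<longleftrightarrow> j > 0 \<and> z ^ j = 1 \<and> (\<forall>i. 0 < i \<and> i < j \<longrightarrow> z ^ i \<noteq> 1)"

definition cyclotomic_poly :: "nat \<Rightarrow> complex poly" where
  "cyclotomic_poly j = (\<Prod>z\<in>{z. primitive_root_of_unity j z}. [:- z, 1:])"

lemma finite_primitive_roots_of_unity: "finite {z. primitive_root_of_unity j z}"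
proof (cases "j > 0")
  case True
  then have "finite {z::complex. z ^ j = 1}"
    by (simp add: finite_roots_unity)
  then show ?thesis
    by (rule rev_finite_subset) (auto simp: primitive_root_of_unity_def)
qed (simp add: primitive_root_of_unity_def)

lemma associated_poly_unique:
  fixes P Q :: "int poly"
  assumes "\<And>x::complex. x \<noteq> 0 \<Longrightarrow> poly (map_poly of_int P) x = f x"
    and "\<And>x::complex. x \<noteq> 0 \<Longrightarrow> poly (map_poly of_int Q) x = f x"
  shows "P = Q"
proof -
  let ?D = "map_poly of_int P - map_poly of_int Q :: complex poly"
  have "- {0} \<subseteq> {x. poly ?D x = 0}"
    using assms by auto
  moreover have "infinite (- {0 :: complex})"
    by (simp add: infinite_UNIV_char_0)
  ultimately have "infinite {x. poly ?D x = 0}"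
    by (rule infinite_super)
  then have "?D = 0"
    by (metis poly_roots_finite)
  then have "map_poly of_int P = (map_poly of_int Q :: complex poly)"
    by (rule eq_iff_diff_eq_0[THEN iffD2])
  then show ?thesis
    by (rule of_int_poly_hom.injectivity)
qed

definition associated_poly_sum :: "nat \<Rightarrow> int poly \<Rightarrow> int poly" where
  "associated_poly_sum n a = (\<Sum>i\<le>n. Polynomial.smult (coeff a i)
    ([:0, 1:] ^ (n - i) * [:1, 0, 1:] ^ i))"

lemma poly_associated_poly_sum:
  fixes x :: complex
  assumes "degree a \<le> n" and "x \<noteq> 0"
  shows "poly (map_poly of_int (associated_poly_sum n a)) x =
    x ^ n * poly (map_poly of_int a) (x + 1 / x)"
proof -
  have *: "x ^ (n - i) * (1 + x * x) ^ i = x ^ n * (x + 1 / x) ^ i" if "i \<le> n" for i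
  proof -
    have "1 + x * x = x * (x + 1 / x)"
      using assms(2) by (simp add: field_simps)
    then have "x ^ (n - i) * (1 + x * x) ^ i = x ^ (n - i) * x ^ i * (x + 1 / x) ^ i"
      by (simp only: power_mult_distrib mult.assoc)
    also have "x ^ (n - i) * x ^ i = x ^ n"
      using that by (simp flip: power_add)
    finally show ?thesis .
  qed
  have "poly (map_poly of_int (associated_poly_sum n a)) x =
      (\<Sum>i\<le>n. of_int (coeff a i) * (x ^ (n - i) * (1 + x * x) ^ i))"
    by (simp add: associated_poly_sum_def hom_distribs poly_sum)
  also have "\<dots> = (\<Sum>i\<le>n. of_int (coeff a i) * (x ^ n * (x + 1 / x) ^ i))"
    by (intro sum.cong refl) (simp add: *)
  also have "\<dots> = x ^ n * (\<Sum>i\<le>n. of_int (coeff a i) * (x + 1 / x) ^ i)"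
    by (simp add: sum_distrib_left mult_ac)
  also have "(\<Sum>i\<le>n. of_int (coeff a i) * (x + 1 / x) ^ i) = poly (map_poly of_int a) (x + 1 / x)"
    unfolding poly_altdef using assms(1)
    by (intro sum.mono_neutral_cong_right) (auto simp: coeff_map_poly degree_map_poly coeff_eq_0)
  finally show ?thesis .
qed

lemma coxeter_adjacency_carrier:
  "C \<in> carrier_mat n n \<Longrightarrow> coxeter_adjacency C \<in> carrier_mat n n"
  by (auto simp: coxeter_adjacency_def)

lemma associated_poly_eq_sum:
  assumes "C \<in> carrier_mat n n"
  shows "associated_poly C = associated_poly_sum n (char_poly (coxeter_adjacency C))"
  unfolding associated_poly_def
proof (rule the_equality)
  let ?a = "char_poly (coxeter_adjacency C)"
  have n: "dim_row C = n" and "degree ?a \<le> n"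
    using assms degree_monic_char_poly[OF coxeter_adjacency_carrier[OF assms]] by auto
  then show *: "\<forall>x::complex. x \<noteq> 0 \<longrightarrow> poly (map_poly of_int (associated_poly_sum n ?a)) x =
      x ^ dim_row C * poly (map_poly of_int ?a) (x + 1 / x)"
    unfolding n using poly_associated_poly_sum by blast
  show "Q = associated_poly_sum n ?a"
    if "\<forall>x::complex. x \<noteq> 0 \<longrightarrow> poly (map_poly of_int Q) x =
      x ^ dim_row C * poly (map_poly of_int ?a) (x + 1 / x)" for Q
    using that *
    by (intro associated_poly_unique
          [where f = "\<lambda>x. x ^ dim_row C * poly (map_poly of_int ?a) (x + 1 / x)"]) metis+
qed

lemma poly_associated_poly:
  fixes x :: complex
  assumes "C \<in> carrier_mat n n" and "x \<noteq> 0"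
  shows "poly (map_poly of_int (associated_poly C)) x =
    x ^ n * poly (map_poly of_int (char_poly (coxeter_adjacency C))) (x + 1 / x)"
  using assms degree_monic_char_poly[OF coxeter_adjacency_carrier[OF assms(1)]]
  by (simp add: associated_poly_eq_sum[OF assms(1)] poly_associated_poly_sum)

lemma degree_associated_poly:
  assumes "C \<in> carrier_mat n n"
  shows "degree (associated_poly C) = 2 * n"
proof -
  let ?a = "char_poly (coxeter_adjacency C)"
  let ?t = "\<lambda>i. Polynomial.smult (coeff ?a i) ([:0, 1:] ^ (n - i) * [:1, 0, 1:] ^ i)"
  have a: "coeff ?a n = 1"
    using degree_monic_char_poly[OF coxeter_adjacency_carrier[OF assms]] by simp
  have deg: "degree ([:0, 1:] ^ (n - i) * [:1, 0, 1:] ^ i :: int poly) = n + i" if "i \<le> n" for i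
    using that by (simp add: degree_mult_eq degree_power_eq)
  have "degree (\<Sum>i<n. ?t i) < 2 * n" if "n > 0"
  proof (rule degree_sum_less)
    show "degree (?t i) < 2 * n" if "i \<in> {..<n}" for i
      using that deg[of i] degree_smult_le[of "coeff ?a i" "[:0, 1:] ^ (n - i) * [:1, 0, 1:] ^ i"]
      by simp
  qed (use that in simp)
  moreover have "degree (?t n) = 2 * n"
    using deg[of n] a by simp
  moreover have "(\<Sum>i\<le>n. ?t i) = (\<Sum>i<n. ?t i) + ?t n"
    by (simp flip: lessThan_Suc_atMost)
  ultimately show ?thesis
    unfolding associated_poly_eq_sum[OF assms] associated_poly_sum_def
    by (cases "n = 0") (simp_all add: degree_add_eq_right)
qed

end

theory Submission
  imports Defs "HOL-Computational_Algebra.Fundamental_Theorem_Algebra"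
begin

text \<open>
  Expanding the determinant gives \<open>a\<^sub>n\<^sub>+\<^sub>2(t) = t a\<^sub>n\<^sub>+\<^sub>1(t) - a\<^sub>n(t)\<close>, so at \<open>t = x + 1/x\<close> induction yields
  \<open>(x\<^sup>2 - 1) Q\<^sub>n(x) = x\<^bsup>2n+2\<^esup> - 1\<close>. The right-hand side is the product of \<open>\<Phi>\<^sub>j\<close> over all divisors
  \<open>j\<close> of \<open>2n + 2\<close>, and \<open>x\<^sup>2 - 1 = \<Phi>\<^sub>1 \<Phi>\<^sub>2\<close> cancels.
\<close>

text \<open>With \<open>t\<close> the polynomial variable this is the characteristic matrix of the
  Coxeter adjacency matrix of type A, whose diagonal is 0 and whose off-diagonal band is 1.\<close>

definition tridiagonal :: "'a::comm_ring_1 \<Rightarrow> nat \<Rightarrow> 'a mat" where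
  "tridiagonal t n = mat n n (\<lambda>(i, j). if i = j then t else if i = j + 1 \<or> j = i + 1 then -1 else 0)"

lemma tridiagonal_carrier: "tridiagonal t n \<in> carrier_mat n n"
  by (simp add: tridiagonal_def)

lemma det_tridiagonal_0: "det (tridiagonal t 0) = 1"
  using det_dim_zero[OF tridiagonal_carrier] .

lemma det_tridiagonal_1: "det (tridiagonal t (Suc 0)) = t"
  by (simp add: det_single tridiagonal_def)

text \<open>Laplace expansion along the first row leaves two minors; the second one,
  \<open>M\<close>, is expanded along its first column.\<close>

lemma det_tridiagonal_Suc_Suc:
  "det (tridiagonal t (Suc (Suc n))) = t * det (tridiagonal t (Suc n)) - det (tridiagonal t n)"
proof -
  let ?T = "tridiagonal t (Suc (Suc n))"
  define M where "M = mat_delete ?T 0 1"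
  have M: "M \<in> carrier_mat (Suc n) (Suc n)"
    unfolding M_def using mat_delete_carrier[OF tridiagonal_carrier, of t "Suc (Suc n)"] by simp
  have del: "mat_delete ?T 0 0 = tridiagonal t (Suc n)"
    by (rule eq_matI) (auto simp: tridiagonal_def mat_delete_def)
  have delM: "mat_delete M 0 0 = tridiagonal t n"
    by (rule eq_matI) (auto simp: M_def tridiagonal_def mat_delete_def)
  have "det M = (\<Sum>i<Suc n. M $$ (i, 0) * cofactor M i 0)"
    by (rule laplace_expansion_column[OF M]) simp
  \<comment> \<open>The first column of \<open>M\<close> is -1 followed by zeros.\<close>
  also have "\<dots> = M $$ (0, 0) * cofactor M 0 0"
    by (subst sum.lessThan_Suc_shift)
       (auto intro!: sum.neutral simp: M_def tridiagonal_def mat_delete_def)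
  also have "\<dots> = - det (tridiagonal t n)"
    unfolding cofactor_def delM by (simp add: M_def tridiagonal_def mat_delete_def)
  finally have detM: "det M = - det (tridiagonal t n)" .
  have "det ?T = (\<Sum>j<Suc (Suc n). ?T $$ (0, j) * cofactor ?T 0 j)"
    by (rule laplace_expansion_row[OF tridiagonal_carrier]) simp
  also have "\<dots> = ?T $$ (0, 0) * cofactor ?T 0 0 + ?T $$ (0, 1) * cofactor ?T 0 1"
    by (simp only: sum.lessThan_Suc_shift)
       (auto intro!: sum.neutral simp: tridiagonal_def)
  also have "\<dots> = t * det (tridiagonal t (Suc n)) - det (tridiagonal t n)"
    unfolding cofactor_def del M_def[symmetric] detM by (simp add: tridiagonal_def)
  finally show ?thesis .
qed

lemma char_poly_coxeter_adjacency_A: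
  "char_poly (coxeter_adjacency (cartan_matrix_A n)) = det (tridiagonal [:0, 1:] n)"
proof -
  have "char_poly_matrix (coxeter_adjacency (cartan_matrix_A n)) = tridiagonal [:0, 1:] n"
    by (rule eq_matI)
       (auto simp: char_poly_matrix_def coxeter_adjacency_def cartan_matrix_A_def tridiagonal_def
          one_pCons)
  then show ?thesis
    by (simp add: char_poly_def)
qed

text \<open>Both sides satisfy u(n+2) = (x^2 + 1) u(n+1) - x^2 u(n), a recurrence with
  characteristic roots 1 and x^2. Keeping the factor x^2 - 1 on the left avoids excluding x = 1 and
  x = -1.\<close>

lemma poly_det_tridiagonal:
  fixes x :: complex
  assumes "x \<noteq> 0"
  shows "(x\<^sup>2 - 1) * (x ^ n * poly (map_poly of_int (det (tridiagonal [:0, 1:] n))) (x + 1 / x)) =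
    x ^ (2 * n + 2) - 1"
proof (induction n rule: induct_nat_012)
  case 0
  then show ?case by (simp add: det_tridiagonal_0 power2_eq_square)
next
  case 1
  then show ?case
    using assms by (simp add: det_tridiagonal_1 hom_distribs field_simps power2_eq_square)
next
  case (ge2 n)
  let ?p = "\<lambda>n. poly (map_poly of_int (det (tridiagonal [:0, 1:] n))) (x + 1 / x)"
  have "?p (Suc (Suc n)) = (x + 1 / x) * ?p (Suc n) - ?p n"
    by (simp add: det_tridiagonal_Suc_Suc hom_distribs)
  moreover have "x * (x + 1 / x) = x\<^sup>2 + 1"
    using assms by (simp add: distrib_left power2_eq_square)
  \<comment> \<open>Multiplying by \<open>x\<close> clears the fraction 1/x.\<close>
  ultimately have rec: "x * ?p (Suc (Suc n)) = (x\<^sup>2 + 1) * ?p (Suc n) - x * ?p n"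
    by (simp only: right_diff_distrib flip: mult.assoc)
  have "(x\<^sup>2 - 1) * (x ^ Suc (Suc n) * ?p (Suc (Suc n))) =
      (x\<^sup>2 - 1) * x ^ Suc n * (x * ?p (Suc (Suc n)))"
    by simp
  also have "\<dots> =
      (x\<^sup>2 + 1) * ((x\<^sup>2 - 1) * (x ^ Suc n * ?p (Suc n))) - x\<^sup>2 * ((x\<^sup>2 - 1) * (x ^ n * ?p n))"
    unfolding rec by (simp add: algebra_simps power2_eq_square)
  also have "\<dots> = x ^ (2 * Suc (Suc n) + 2) - 1"
    unfolding ge2 by (simp add: algebra_simps power2_eq_square)
  finally show ?case .
qed

text \<open>The two polynomials agree at every nonzero complex number, hence at infinitely many
  points.\<close>

lemma associated_poly_A_mult:
  "[:-1, 0, 1:] * map_poly of_int (associated_poly (cartan_matrix_A n)) =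
    (monom 1 (2 * n + 2) - 1 :: complex poly)" (is "?L = ?R")
proof -
  have "poly ?L x = poly ?R x" if "x \<noteq> 0" for x
    using poly_det_tridiagonal[OF that, of n]
      poly_associated_poly[OF cartan_matrix_A_carrier that, of n]
    by (simp add: char_poly_coxeter_adjacency_A poly_monom algebra_simps power2_eq_square)
  then have "- {0} \<subseteq> {x. poly (?L - ?R) x = 0}"
    by auto
  moreover have "infinite (- {0 :: complex})"
    by (simp add: infinite_UNIV_char_0)
  ultimately have "infinite {x. poly (?L - ?R) x = 0}"
    by (rule infinite_super)
  then show ?thesis
    using poly_roots_finite[of "?L - ?R"] by force
qed

lemma monom_minus_one_eq_prod_roots:
  assumes "m > 0"
  shows "(monom 1 m - 1 :: complex poly) = (\<Prod>z | z ^ m = 1. [:- z, 1:])"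
proof -
  let ?p = "monom 1 m - 1 :: complex poly"
  \<comment> \<open>The derivative can vanish only at 0, where \<open>?p\<close> is -1, so no root
    is multiple.\<close>
  have "rsquarefree ?p"
    using assms by (auto simp: rsquarefree_roots pderiv_diff pderiv_monom poly_monom zero_power)
  then have "Polynomial.smult (lead_coeff ?p) (\<Prod>z | poly ?p z = 0. [:- z, 1:]) = ?p"
    by (rule complex_poly_decompose_rsquarefree)
  moreover have "degree ?p = m"
    using assms by (simp add: degree_monom_eq diff_conv_add_uminus degree_add_eq_left del: add_uminus_conv_diff)
  ultimately show ?thesis
    using assms by (simp add: poly_monom)
qed

text \<open>Division with remainder gives \<open>z ^ (m mod j) = 1\<close>, and minimality of
  \<open>j\<close> forces the remainder to be 0.\<close>

lemma primitive_root_of_unity_dvd: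
  assumes "primitive_root_of_unity j z" and "z ^ m = 1"
  shows "j dvd m"
proof -
  have j: "j > 0" "z ^ j = 1" "\<And>i. 0 < i \<Longrightarrow> i < j \<Longrightarrow> z ^ i \<noteq> 1"
    using assms(1) by (auto simp: primitive_root_of_unity_def)
  have "z ^ m = (z ^ j) ^ (m div j) * z ^ (m mod j)"
    by (simp flip: power_mult power_add)
  then have "z ^ (m mod j) = 1"
    using assms(2) j(2) by simp
  then show ?thesis
    using j(1) j(3)[of "m mod j"] by (auto simp: dvd_eq_mod_eq_0)
qed

lemma ex_primitive_root_of_unity:
  assumes "m > 0" and "z ^ m = 1"
  shows "\<exists>j. primitive_root_of_unity j z"
proof
  let ?P = "\<lambda>j. 0 < j \<and> z ^ j = 1"
  have "?P (LEAST j. ?P j)"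
    using assms by (intro LeastI[where P = ?P and k = m]) auto
  then show "primitive_root_of_unity (LEAST j. ?P j) z"
    using not_less_Least[where P = ?P] unfolding primitive_root_of_unity_def by blast
qed

text \<open>The m-th roots of unity are partitioned by their order, which ranges over divisors of
  \<open>m\<close>.\<close>

lemma prod_cyclotomic_poly:
  assumes "m > 0"
  shows "(\<Prod>j | j dvd m. cyclotomic_poly j) = monom 1 m - 1"
proof -
  have "{z. z ^ m = 1} = (\<Union>j\<in>{j. j dvd m}. {z. primitive_root_of_unity j z})"
  proof (intro equalityI subsetI)
    fix z :: complex assume "z \<in> {z. z ^ m = 1}"
    then show "z \<in> (\<Union>j\<in>{j. j dvd m}. {z. primitive_root_of_unity j z})"
      using ex_primitive_root_of_unity[OF assms] primitive_root_of_unity_dvd by blast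
  qed (auto simp: primitive_root_of_unity_def power_mult elim!: dvdE)
  \<comment> \<open>Two orders of the same \<open>z\<close> divide each other, so the classes are
    disjoint.\<close>
  moreover have "j = k" if "primitive_root_of_unity j z" "primitive_root_of_unity k z" for j k z
    using that primitive_root_of_unity_dvd[of j z k] primitive_root_of_unity_dvd[of k z j]
    by (auto simp: primitive_root_of_unity_def intro: dvd_antisym)
  ultimately show ?thesis
    unfolding monom_minus_one_eq_prod_roots[OF assms] cyclotomic_poly_def
    using assms finite_primitive_roots_of_unity
    by (subst prod.UNION_disjoint[symmetric]) auto
qed

text \<open>This is the case m = 2 of the product formula, so neither factor has to be
  computed.\<close>

lemma prod_cyclotomic_poly_1_2: "cyclotomic_poly 1 * cyclotomic_poly 2 = [:-1, 0, 1:]"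
proof -
  have "{j. j dvd 2} = {1, 2 :: nat}"
    using two_is_prime_nat by (auto simp: prime_nat_iff)
  then have "cyclotomic_poly 1 * cyclotomic_poly 2 = monom 1 2 - 1"
    using prod_cyclotomic_poly[of 2] by simp
  then show ?thesis
    by (simp add: monom_altdef power2_eq_square one_pCons)
qed

theorem proposition8:
  fixes n :: nat
  assumes "n \<ge> 1"
  shows "map_poly of_int (associated_poly (cartan_matrix_A n)) =
    (\<Prod>j\<in>{j. j dvd 2 * n + 2 \<and> j \<noteq> 1 \<and> j \<noteq> 2}. cyclotomic_poly j)"
proof -
  let ?D = "{j. j dvd 2 * n + 2 \<and> j \<noteq> 1 \<and> j \<noteq> 2}"
  have "{j. j dvd 2 * n + 2} = insert 1 (insert 2 ?D)"
    by auto
  moreover have "finite ?D"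
    by (rule finite_subset[of _ "{j. j dvd 2 * n + 2}"]) auto
  ultimately have "(\<Prod>j | j dvd 2 * n + 2. cyclotomic_poly j) =
      cyclotomic_poly 1 * cyclotomic_poly 2 * (\<Prod>j\<in>?D. cyclotomic_poly j)"
    by (simp add: mult.assoc)
  then have "[:-1, 0, 1:] * map_poly of_int (associated_poly (cartan_matrix_A n)) =
      [:-1, 0, 1:] * (\<Prod>j\<in>?D. cyclotomic_poly j)"
    unfolding associated_poly_A_mult prod_cyclotomic_poly_1_2
    by (simp add: prod_cyclotomic_poly)
  then show ?thesis
    \<comment> \<open>Complex polynomials form an integral domain, so the nonzero factor x^2 - 1
      cancels.\<close>
    by (subst (asm) mult_left_cancel) simp_all
qed

end
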